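(* A minimal homogeneous generating set for $M=\widetilde H^*(MO(2);\mathbb F_2)$ as an $\mathcal A(1)$-module is the disjoint union $\mathcal G_{2,3}\cup\mathcal G_{0,1}$, where $$\mathcal G_{2,3}=\{v_{4a,\,2+4b}: a,b\ge 0\}\cup\{v_{0,\,3+4a}: a\ge 0\},$$ $$\mathcal G_{0,1}=\{v_{4a+2,\,4b}: a,b\ge 0\}\cup\{v_{0,\,4a}: a\ge 0\}.$$ Consequently, with internal degree recorded by $t$, $$P_{Q^{(1)}M}(t)=\frac{t^2+t^4}{(1-t^4)(1-t^8)}+\frac{1+t^6}{1-t^8}.$$ The corresponding series in cohomological degree is $P^{\mathrm{coh}}_{Q^{(1)}M}(t)=t^2P_{Q^{(1)}M}(t)$.
   Context: Let $M=\widetilde H^*(MO(2);\mathbb F_2)$ be the reduced mod $2$ cohomology of the Thom space $MO(2)$ of the universal real two-plane bundle. With $H^*(BO(2);\mathbb F_2)=\mathbb F_2[w_1,w_2]$ ($|w_1|=1$, $|w_2|=2$, Stiefel--Whitney classes), $M=u\,\mathbb F_2[w_1,w_2]$ is free on the Thom class $u$ of degree $2$. For $n,m\ge 0$ let $v_{n,m}=u\,w_1^n w_2^m$; these form an $\mathbb F_2$-basis of $M$. The internal degree of $v_{n,m}$ is $n+2m$ and its cohomological degree is $n+2m+2$. For $h\ge 0$ let $M_h=\mathrm{span}_{\mathbb F_2}\{v_{n,m}: n+2m=h\}$. Let $\mathcal A(1)$ be the subalgebra of the mod $2$ Steenrod algebra generated by $\mathrm{Sq}^1,\mathrm{Sq}^2$,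 with augmentation ideal $\mathcal A(1)^+$ (its elements of positive degree). The action on $M$ is given by $$\mathrm{Sq}^1(v_{n,m})=(n+m+1)v_{n+1,m},\qquad \mathrm{Sq}^2(v_{n,m})=\binom{n+m+1}{2}v_{n+2,m}+(m+1)v_{n,m+1},$$ with coefficients reduced modulo $2$. Put $Q_h^{(1)}M=M_h/(\mathcal A(1)^+M)_h$ (component of internal degree $h$), $Q^{(1)}M=\bigoplus_{h\ge0}Q_h^{(1)}M$, and $P_{Q^{(1)}M}(t)=\sum_{h\ge 0}\dim_{\mathbb F_2}(Q_h^{(1)}M)\,t^h$. $P^{\mathrm{coh}}_{Q^{(1)}M}(t)$ denotes the analogous Hilbert series of $Q^{(1)}M$ graded by cohomological degree instead of internal degree. A minimal homogeneous generating set is a set of homogeneous elements generating $M$ as an $\mathcal A(1)$-module from which no element can be removed. *)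

theory Defs
  imports
    "HOL-Library.Z2"
    "HOL-Library.Poly_Mapping"
    "HOL-Computational_Algebra.Formal_Power_Series"
    "Jordan_Normal_Form.VS_Connect"
begin

section \<open>The mod 2 Steenrod algebra\<close>

text \<open>
  The Steenrod algebra is the free associative \<open>\<bbbF>\<^sub>2\<close>-algebra on symbols \<open>Sq\<^sup>i\<close> (\<open>i \<ge> 0\<close>), modulo
  \<open>Sq\<^sup>0 = 1\<close> and the Adem relations. The free algebra is the monoid algebra over the type \<open>bit\<close>
  (the field with two elements) of the free monoid of words; its multiplication is the
  convolution product that \<open>Poly_Mapping\<close> derives from the addition of the exponent type, whence
  concatenation of words is written additively.
\<close>

datatype sq_word = Word (letters: "nat list")

instantiation sq_word :: monoid_add
begin

definition zero_sq_word :: sq_word where "0 = Word []"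

definition plus_sq_word :: "sq_word \<Rightarrow> sq_word \<Rightarrow> sq_word" where
  "v + w = Word (letters v @ letters w)"

instance
  by standard (simp_all add: zero_sq_word_def plus_sq_word_def)

end

definition word_degree :: "sq_word \<Rightarrow> nat" where
  "word_degree w = sum_list (letters w)"

type_synonym free_sq_algebra = "sq_word \<Rightarrow>\<^sub>0 bit"

definition free_Sq :: "nat \<Rightarrow> free_sq_algebra" where
  "free_Sq i = Poly_Mapping.single (Word [i]) 1"

inductive_set adem_relators :: "free_sq_algebra set" where
  unit: "free_Sq 0 - 1 \<in> adem_relators"
| adem: "0 < a \<Longrightarrow> a < 2 * b \<Longrightarrow>
    free_Sq a * free_Sq b
      - (\<Sum>j\<le>a div 2. of_nat ((b - j - 1) choose (a - 2 * j)) * (free_Sq (a + b - j) * free_Sq j))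
    \<in> adem_relators"

inductive_set adem_ideal :: "free_sq_algebra set" where
  zero: "0 \<in> adem_ideal"
| relator: "r \<in> adem_relators \<Longrightarrow> p * r * q \<in> adem_ideal"
| add: "p \<in> adem_ideal \<Longrightarrow> q \<in> adem_ideal \<Longrightarrow> p + q \<in> adem_ideal"

lemma adem_ideal_mult_left: "p \<in> adem_ideal \<Longrightarrow> s * p \<in> adem_ideal"
proof (induction rule: adem_ideal.induct)
  case (relator r p q)
  then show ?case
    using adem_ideal.relator[of r "s * p" q] by (simp add: mult.assoc)
qed (auto simp: distrib_left intro: adem_ideal.intros)

lemma adem_ideal_mult_right: "p \<in> adem_ideal \<Longrightarrow> p * s \<in> adem_ideal"
proof (induction rule: adem_ideal.induct)
  case (relator r p q)
  then show ?case
    using adem_ideal.relator[of r p "q * s"] by (simp add: mult.assoc)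
qed (auto simp: distrib_right intro: adem_ideal.intros)

lemma adem_ideal_uminus: "p \<in> adem_ideal \<Longrightarrow> - p \<in> adem_ideal"
  using adem_ideal_mult_left[of p "- 1"] by simp

lemma adem_ideal_diff: "p \<in> adem_ideal \<Longrightarrow> q \<in> adem_ideal \<Longrightarrow> p - q \<in> adem_ideal"
  using adem_ideal.add[of p "- q"] adem_ideal_uminus[of q] by simp

lemma poly_mapping_plus_induct [case_names zero add]:
  fixes p :: "'k \<Rightarrow>\<^sub>0 'c::comm_monoid_add"
  assumes "P 0" "\<And>k c q. P q \<Longrightarrow> P (Poly_Mapping.single k c + q)"
  shows "P p"
proof (induction p rule: update_induct)
  case const
  show ?case by (rule assms(1))
next
  case (update f a b)
  have "Poly_Mapping.update a b f = Poly_Mapping.single a b + f"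
    using update(1)
    by (intro poly_mapping_eqI) (simp add: update.rep_eq lookup_add lookup_single in_keys_iff when_def)
  with update assms(2) show ?case by simp
qed

text \<open>
  The ideal is proper: the augmentation of the free algebra, which sends \<open>Sq\<^sup>0\<close> to 1 and every
  other \<open>Sq\<^sup>i\<close> to 0, vanishes on it.
\<close>

definition free_augmentation :: "free_sq_algebra \<Rightarrow> bit" where
  "free_augmentation p =
    (\<Sum>w\<in>Poly_Mapping.keys p. if word_degree w = 0 then Poly_Mapping.lookup p w else 0)"

lemma word_degree_add [simp]: "word_degree (v + w) = word_degree v + word_degree w"
  by (simp add: word_degree_def plus_sq_word_def)

lemma word_degree_Word [simp]: "word_degree (Word l) = sum_list l"
  by (simp add: word_degree_def)

lemma word_degree_zero [simp]: "word_degree 0 = 0"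
  by (simp add: zero_sq_word_def)

lemma free_augmentation_superset:
  assumes "finite S" "Poly_Mapping.keys p \<subseteq> S"
  shows "free_augmentation p = (\<Sum>w\<in>S. if word_degree w = 0 then Poly_Mapping.lookup p w else 0)"
  unfolding free_augmentation_def
  by (rule sum.mono_neutral_left) (use assms in \<open>auto simp: in_keys_iff\<close>)

lemma free_augmentation_zero [simp]: "free_augmentation 0 = 0"
  by (simp add: free_augmentation_def)

lemma free_augmentation_add [simp]:
  "free_augmentation (p + q) = free_augmentation p + free_augmentation q"
proof -
  let ?S = "Poly_Mapping.keys p \<union> Poly_Mapping.keys q"
  have eq: "free_augmentation r = (\<Sum>w\<in>?S. if word_degree w = 0 then Poly_Mapping.lookup r w else 0)"
    if "Poly_Mapping.keys r \<subseteq> ?S" for r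
    by (rule free_augmentation_superset) (simp_all add: that)
  show ?thesis
    unfolding eq[OF Poly_Mapping.keys_add] eq[OF Un_upper1] eq[OF Un_upper2]
      sum.distrib[symmetric] lookup_add
    by (intro sum.cong refl) simp
qed

lemma free_augmentation_single:
  "free_augmentation (Poly_Mapping.single w c) = (if word_degree w = 0 then c else 0)"
  by (simp add: free_augmentation_def)

lemma free_augmentation_uminus [simp]: "free_augmentation (- p) = - free_augmentation p"
proof -
  have "free_augmentation p + free_augmentation (- p) = free_augmentation 0"
    by (simp only: free_augmentation_add[symmetric] right_minus)
  then show ?thesis
    unfolding free_augmentation_zero by (rule minus_unique[symmetric])
qed

lemma free_augmentation_diff [simp]:
  "free_augmentation (p - q) = free_augmentation p - free_augmentation q"
  using free_augmentation_add[of p "- q"]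
  by (simp only: free_augmentation_uminus diff_conv_add_uminus)

lemma free_augmentation_mult [simp]:
  "free_augmentation (p * q) = free_augmentation p * free_augmentation q"
proof -
  have 1: "free_augmentation (Poly_Mapping.single v a * Poly_Mapping.single w b)
      = free_augmentation (Poly_Mapping.single v a) * free_augmentation (Poly_Mapping.single w b)"
    for v w a b by (simp add: mult_single free_augmentation_single)
  have 2: "free_augmentation (Poly_Mapping.single v a * q)
      = free_augmentation (Poly_Mapping.single v a) * free_augmentation q" for v a
    by (induction q rule: poly_mapping_plus_induct)
      (simp_all add: 1 distrib_left)
  show ?thesis
    by (induction p rule: poly_mapping_plus_induct)
      (simp_all add: 2 distrib_right)
qed

lemma free_augmentation_one [simp]: "free_augmentation 1 = 1"
  using free_augmentation_single[of 0 1] by simp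

lemma free_augmentation_sum: "free_augmentation (sum f S) = (\<Sum>x\<in>S. free_augmentation (f x))"
  by (induction S rule: infinite_finite_induct) simp_all

lemma free_augmentation_Sq: "free_augmentation (free_Sq i) = (if i = 0 then 1 else 0)"
  by (simp add: free_Sq_def free_augmentation_single)

lemma free_augmentation_relator:
  assumes "r \<in> adem_relators"
  shows "free_augmentation r = 0"
  using assms
proof cases
  case unit
  then show ?thesis by (simp add: free_augmentation_Sq)
next
  case (adem a b)
  have "free_augmentation
      (of_nat ((b - j - 1) choose (a - 2 * j)) * (free_Sq (a + b - j) * free_Sq j)) = 0"
    if "j \<le> a div 2" for j
  proof -
    have "a + b - j \<noteq> 0"
      using that adem by linarith
    then show ?thesis
      by (simp add: free_augmentation_Sq)
  qed
  then have "(\<Sum>j\<le>a div 2. free_augmentation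
      (of_nat ((b - j - 1) choose (a - 2 * j)) * (free_Sq (a + b - j) * free_Sq j))) = 0"
    by (intro sum.neutral) blast
  moreover have "free_augmentation (free_Sq a * free_Sq b) = 0"
    using adem by (simp add: free_augmentation_Sq)
  ultimately show ?thesis
    unfolding adem free_augmentation_diff free_augmentation_sum by simp
qed

lemma free_augmentation_ideal: "p \<in> adem_ideal \<Longrightarrow> free_augmentation p = 0"
  by (induction rule: adem_ideal.induct) (simp_all add: free_augmentation_relator)

quotient_type steenrod = "sq_word \<Rightarrow>\<^sub>0 bit" / "\<lambda>p q. p - q \<in> adem_ideal"
  morphisms rep_steenrod steenrod_class
proof (rule equivpI)
  show "reflp (\<lambda>p q. p - q \<in> adem_ideal)"
    by (rule reflpI) (simp add: adem_ideal.zero)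
  show "symp (\<lambda>p q. p - q \<in> adem_ideal)"
    by (rule sympI) (metis adem_ideal_uminus minus_diff_eq)
  show "transp (\<lambda>p q. p - q \<in> adem_ideal)"
    by (rule transpI) (metis adem_ideal.add diff_add_cancel add_diff_eq)
qed

instantiation steenrod :: ring_1
begin

lift_definition zero_steenrod :: steenrod is "0" .
lift_definition one_steenrod :: steenrod is "1" .

lift_definition plus_steenrod :: "steenrod \<Rightarrow> steenrod \<Rightarrow> steenrod" is "(+)"
  by (metis adem_ideal.add add_diff_add)

lift_definition minus_steenrod :: "steenrod \<Rightarrow> steenrod \<Rightarrow> steenrod" is "(-)"
  by (metis adem_ideal_diff diff_diff_eq2 diff_add_eq diff_diff_add add.commute)

lift_definition uminus_steenrod :: "steenrod \<Rightarrow> steenrod" is "uminus"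
  by (metis adem_ideal_uminus minus_diff_minus)

lift_definition times_steenrod :: "steenrod \<Rightarrow> steenrod \<Rightarrow> steenrod" is "(*)"
proof -
  fix p p' q q' :: free_sq_algebra
  assume *: "p - p' \<in> adem_ideal" "q - q' \<in> adem_ideal"
  have "p * q - p' * q' = (p - p') * q + p' * (q - q')"
    by (simp add: algebra_simps)
  with * show "p * q - p' * q' \<in> adem_ideal"
    by (simp add: adem_ideal.add adem_ideal_mult_left adem_ideal_mult_right)
qed

instance
proof
  show "(0 :: steenrod) \<noteq> 1"
    by transfer (use free_augmentation_ideal in force)
qed (transfer; simp add: algebra_simps adem_ideal.zero)+

end

definition Sq :: "nat \<Rightarrow> steenrod" where
  "Sq i = steenrod_class (free_Sq i)"

inductive_set A1 :: "steenrod set" where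
  zero: "0 \<in> A1"
| one: "1 \<in> A1"
| Sq1: "Sq 1 \<in> A1"
| Sq2: "Sq 2 \<in> A1"
| add: "a \<in> A1 \<Longrightarrow> b \<in> A1 \<Longrightarrow> a + b \<in> A1"
| mult: "a \<in> A1 \<Longrightarrow> b \<in> A1 \<Longrightarrow> a * b \<in> A1"

text \<open>
  The Steenrod algebra is graded by the degree of words. The augmentation ideal of \<open>\<A>(1)\<close>
  consists of the elements whose homogeneous components all have positive degree, i.e. those
  represented by a combination of words of positive degree.
\<close>

definition A1_plus :: "steenrod set" where
  "A1_plus = A1 \<inter> {steenrod_class p | p. \<forall>w\<in>Poly_Mapping.keys p. 0 < word_degree w}"

section \<open>The cohomology of the Thom space $MO(2)$\<close>

text \<open>
  The monomial \<open>u w\<^sub>1\<^sup>n w\<^sub>2\<^sup>m\<close> is encoded by the pair of exponents \<open>(n, m)\<close>; only the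
  \<open>\<bbbF>\<^sub>2\<close>-vector space structure of \<open>u \<bbbF>\<^sub>2[w\<^sub>1, w\<^sub>2]\<close> is used.
\<close>

type_synonym MO2 = "(nat \<times> nat) \<Rightarrow>\<^sub>0 bit"

definition scale :: "bit \<Rightarrow> MO2 \<Rightarrow> MO2" where
  "scale c x = Poly_Mapping.map ((*) c) x"

definition v :: "nat \<Rightarrow> nat \<Rightarrow> MO2" where
  "v n m = Poly_Mapping.single (n, m) 1"

lemma lookup_scale [simp]: "Poly_Mapping.lookup (scale c x) k = c * Poly_Mapping.lookup x k"
  by (simp add: scale_def Poly_Mapping.map.rep_eq when_def)

global_interpretation MO2: vector_space scale
  by standard (auto intro!: poly_mapping_eqI simp: lookup_add algebra_simps)

definition M_int :: "nat \<Rightarrow> MO2 set" where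
  "M_int h = MO2.span {v n m | n m. n + 2 * m = h}"

definition M_coh :: "nat \<Rightarrow> MO2 set" where
  "M_coh d = MO2.span {v n m | n m. n + 2 * m + 2 = d}"

section \<open>Modules over $\mathcal{A}(1)$\<close>

text \<open>An action is a map on the whole Steenrod algebra, but only its values on \<open>A1\<close> are relevant.\<close>

definition A1_module :: "(steenrod \<Rightarrow> MO2 \<Rightarrow> MO2) \<Rightarrow> bool" where
  "A1_module act \<longleftrightarrow>
    (\<forall>a\<in>A1. \<forall>x y. act a (x + y) = act a x + act a y) \<and>
    (\<forall>a\<in>A1. \<forall>b\<in>A1. \<forall>x. act (a + b) x = act a x + act b x) \<and>
    (\<forall>a\<in>A1. \<forall>b\<in>A1. \<forall>x. act (a * b) x = act a (act b x)) \<and>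
    (\<forall>x. act 1 x = x)"

definition A1_submodule :: "(steenrod \<Rightarrow> MO2 \<Rightarrow> MO2) \<Rightarrow> MO2 set \<Rightarrow> bool" where
  "A1_submodule act N \<longleftrightarrow>
    0 \<in> N \<and> (\<forall>x\<in>N. \<forall>y\<in>N. x + y \<in> N) \<and> (\<forall>a\<in>A1. \<forall>x\<in>N. act a x \<in> N)"

definition A1_generates :: "(steenrod \<Rightarrow> MO2 \<Rightarrow> MO2) \<Rightarrow> MO2 set \<Rightarrow> bool" where
  "A1_generates act G \<longleftrightarrow> A1_submodule act hull G = UNIV"

definition minimal_homogeneous_generating_set ::
    "(steenrod \<Rightarrow> MO2 \<Rightarrow> MO2) \<Rightarrow> MO2 set \<Rightarrow> bool" where
  "minimal_homogeneous_generating_set act G \<longleftrightarrow>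
    (\<forall>g\<in>G. \<exists>h. g \<in> M_int h) \<and> A1_generates act G \<and> (\<forall>g\<in>G. \<not> A1_generates act (G - {g}))"

definition A1_plus_M :: "(steenrod \<Rightarrow> MO2 \<Rightarrow> MO2) \<Rightarrow> MO2 set" where
  "A1_plus_M act = MO2.span {act a x | a x. a \<in> A1_plus}"

section \<open>Indecomposables and their Hilbert series\<close>

text \<open>
  The quotient \<open>V / W\<close> of a subspace \<open>V\<close> of \<open>M\<close> by a subspace \<open>W\<close> of \<open>V\<close>, as the vector space of
  cosets. The ring multiplication and unit that the record type requires play no role.
\<close>

definition quotient_space :: "MO2 set \<Rightarrow> MO2 set \<Rightarrow> (bit, MO2 set) module" where
  "quotient_space V W =
    \<lparr> carrier = (\<lambda>x. {x + w | w. w \<in> W}) ` V,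
      mult = undefined,
      one = undefined,
      zero = W,
      add = (\<lambda>X Y. {x + y | x y. x \<in> X \<and> y \<in> Y}),
      smult = (\<lambda>c X. {scale c x + w | x w. x \<in> X \<and> w \<in> W}) \<rparr>"

definition Q_int :: "(steenrod \<Rightarrow> MO2 \<Rightarrow> MO2) \<Rightarrow> nat \<Rightarrow> (bit, MO2 set) module" where
  "Q_int act h = quotient_space (M_int h) (A1_plus_M act \<inter> M_int h)"

definition Q_coh :: "(steenrod \<Rightarrow> MO2 \<Rightarrow> MO2) \<Rightarrow> nat \<Rightarrow> (bit, MO2 set) module" where
  "Q_coh act d = quotient_space (M_coh d) (A1_plus_M act \<inter> M_coh d)"

definition hilbert_series :: "(nat \<Rightarrow> (bit, MO2 set) module) \<Rightarrow> rat fps" where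
  "hilbert_series Q = Abs_fps (\<lambda>h. of_nat (vectorspace.dim class_ring (Q h)))"

definition G23 :: "MO2 set" where
  "G23 = {v (4 * a) (2 + 4 * b) | a b. True} \<union> {v 0 (3 + 4 * a) | a. True}"

definition G01 :: "MO2 set" where
  "G01 = {v (4 * a + 2) (4 * b) | a b. True} \<union> {v 0 (4 * a) | a. True}"

end

theory Submission
  imports Defs
begin

text \<open>
  Modulo the images of \<open>Sq\<^sup>1\<close> and \<open>Sq\<^sup>2\<close> every monomial either vanishes, is one of the proposed
  generators, or is \<open>v\<^sub>2\<^sub>m\<close> with \<open>m \<equiv> 2\<close> modulo 4, which is congruent to the generator
  \<open>v\<^sub>0\<^sub>m\<^sub>+\<^sub>1\<close>; induction on the degree then shows that the generators generate. Conversely, each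
  generator has a coordinate functional that vanishes on the images of \<open>Sq\<^sup>1\<close> and \<open>Sq\<^sup>2\<close>. Such a
  functional \<open>\<phi>\<close> satisfies \<open>\<phi> (a x) = \<epsilon>(a) \<phi> x\<close> for the augmentation \<open>\<epsilon>\<close>, so its kernel is a
  submodule, which gives minimality; and the common kernel of all of them is \<open>\<A>(1)\<^sup>+ M\<close>, so in each
  degree the generators form a basis of the indecomposables.
\<close>

section \<open>Quotients of subspaces\<close>

lemma MO2_add_self [simp]: "x + x = (0 :: MO2)"
  by (rule poly_mapping_eqI) (simp add: lookup_add)

text \<open>Names the comprehension from which \<open>quotient_space\<close> builds its carrier, so
  that its operations can be computed on representatives.\<close>

definition coset :: "MO2 set \<Rightarrow> MO2 \<Rightarrow> MO2 set" where
  "coset W x = {x + w | w. w \<in> W}"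

lemma coset_eq_iff:
  assumes "MO2.subspace W"
  shows "coset W x = coset W y \<longleftrightarrow> x - y \<in> W"
proof
  assume "coset W x = coset W y"
  moreover have "x \<in> coset W x"
    unfolding coset_def using MO2.subspace_0[OF assms] by force
  ultimately show "x - y \<in> W"
    by (auto simp: coset_def)
next
  assume *: "x - y \<in> W"
  have "coset W a \<subseteq> coset W b" if "a - b \<in> W" for a b
  proof
    fix z assume "z \<in> coset W a"
    then obtain w where "w \<in> W" "z = a + w" by (auto simp: coset_def)
    then have "z = b + ((a - b) + w)" "(a - b) + w \<in> W"
      using that assms by (simp_all add: MO2.subspace_add)
    then show "z \<in> coset W b" unfolding coset_def by blast
  qed
  from this[of x y] this[of y x] show "coset W x = coset W y"
    using * MO2.subspace_neg[OF assms *] by auto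
qed

lemma coset_zero: "coset W 0 = W"
  by (simp add: coset_def)

lemma carrier_quotient_space: "carrier (quotient_space V W) = coset W ` V"
  by (simp add: quotient_space_def coset_def)

lemma zero_quotient_space: "\<zero>\<^bsub>quotient_space V W\<^esub> = coset W 0"
  by (simp add: quotient_space_def coset_zero)

lemma add_quotient_space:
  assumes "MO2.subspace W"
  shows "coset W x \<oplus>\<^bsub>quotient_space V W\<^esub> coset W y = coset W (x + y)"
proof -
  have "\<exists>w. a + b = x + y + w \<and> w \<in> W"
    if "a = x + s" "b = y + t" "s \<in> W" "t \<in> W" for a b s t
    using that MO2.subspace_add[OF assms] by (intro exI[of _ "s + t"]) (simp add: algebra_simps)
  moreover have "\<exists>a b. x + y + w = a + b \<and> (\<exists>s. a = x + s \<and> s \<in> W) \<and> (\<exists>t. b = y + t \<and> t \<in> W)"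
    if "w \<in> W" for w
    using that MO2.subspace_0[OF assms]
    by (intro exI[of _ x] exI[of _ "y + w"]) (auto simp: algebra_simps intro: exI[of _ 0])
  ultimately show ?thesis
    unfolding quotient_space_def coset_def by auto
qed

lemma smult_quotient_space:
  assumes "MO2.subspace W"
  shows "c \<odot>\<^bsub>quotient_space V W\<^esub> coset W x = coset W (scale c x)"
proof -
  have "\<exists>w. scale c a + t = scale c x + w \<and> w \<in> W"
    if "a = x + s" "s \<in> W" "t \<in> W" for a s t
    using that assms
    by (intro exI[of _ "scale c s + t"])
      (simp add: MO2.scale_right_distrib add.assoc MO2.subspace_add MO2.subspace_scale)
  moreover have "\<exists>a t. scale c x + w = scale c a + t \<and> (\<exists>s. a = x + s \<and> s \<in> W) \<and> t \<in> W"
    if "w \<in> W" for w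
    using that MO2.subspace_0[OF assms]
    by (intro exI[of _ x] exI[of _ w]) (auto intro: exI[of _ 0])
  ultimately show ?thesis
    unfolding quotient_space_def coset_def by auto
qed

lemma vectorspace_quotient_space:
  assumes V: "MO2.subspace V" and W: "MO2.subspace W"
  shows "vectorspace class_ring (quotient_space V W)"
proof (rule vs_criteria)
  show "field (class_ring :: bit ring)" by (rule class_field)
  note simps = carrier_quotient_space zero_quotient_space add_quotient_space[OF W]
    smult_quotient_space[OF W]
  show "\<zero>\<^bsub>quotient_space V W\<^esub> \<in> carrier (quotient_space V W)"
    using MO2.subspace_0[OF V] by (simp add: simps)
  show "\<forall>X\<in>carrier (quotient_space V W). \<exists>Y\<in>carrier (quotient_space V W).
      X \<oplus>\<^bsub>quotient_space V W\<^esub> Y = \<zero>\<^bsub>quotient_space V W\<^esub>"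
  proof
    fix X assume "X \<in> carrier (quotient_space V W)"
    then obtain x where "x \<in> V" "X = coset W x" by (auto simp: simps)
    then show "\<exists>Y\<in>carrier (quotient_space V W).
        X \<oplus>\<^bsub>quotient_space V W\<^esub> Y = \<zero>\<^bsub>quotient_space V W\<^esub>"
      by (intro bexI[of _ "coset W (- x)"]) (auto simp: simps MO2.subspace_neg[OF V])
  qed
qed (auto simp: carrier_quotient_space zero_quotient_space add_quotient_space[OF W]
      smult_quotient_space[OF W] MO2.subspace_add[OF V] MO2.subspace_scale[OF V]
      MO2.scale_right_distrib MO2.scale_left_distrib ac_simps)

lemma finsum_quotient_space:
  assumes V: "MO2.subspace V" and W: "MO2.subspace W" and "finite J" "f ` J \<subseteq> V"
  shows "finsum (quotient_space V W) (\<lambda>j. coset W (f j)) J = coset W (sum f J)"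
proof -
  interpret vectorspace class_ring "quotient_space V W"
    by (rule vectorspace_quotient_space[OF V W])
  show ?thesis
    using assms(3,4)
  proof (induction J rule: finite_induct)
    case empty
    then show ?case by (simp add: zero_quotient_space)
  next
    case (insert j J)
    then have "(\<lambda>j. coset W (f j)) \<in> J \<rightarrow> carrier (quotient_space V W)"
      by (auto simp: carrier_quotient_space)
    with insert show ?case
      by (simp add: finsum_insert carrier_quotient_space add_quotient_space[OF W])
  qed
qed

text \<open>A dual pair of finite families yields a basis of the quotient. Duality makes the cosets
  of the \<open>e i\<close> distinct and independent. They span because \<open>x\<close> minus the
  sum of the \<open>scale (\<phi> i x) (e i)\<close> is killed by every \<open>\<phi> i\<close> and
  hence lies in \<open>W\<close>. No basis of \<open>V\<close> or \<open>W\<close> has to be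
  chosen.\<close>

lemma dim_quotient_space:
  assumes V: "MO2.subspace V" and "finite I" and e: "\<And>i. i \<in> I \<Longrightarrow> e i \<in> V"
    and lin: "\<And>i. i \<in> I \<Longrightarrow> Vector_Spaces.linear scale (*) (\<phi> i)"
    and dual: "\<And>i j. i \<in> I \<Longrightarrow> j \<in> I \<Longrightarrow> \<phi> i (e j) = (if i = j then 1 else 0)"
    and W_def: "W = {x \<in> V. \<forall>i\<in>I. \<phi> i x = 0}"
  shows "vectorspace.dim class_ring (quotient_space V W) = card I"
proof -
  have \<phi>: "\<phi> i 0 = 0" "\<phi> i (x + y) = \<phi> i x + \<phi> i y" "\<phi> i (x - y) = \<phi> i x - \<phi> i y"
    "\<phi> i (scale c x) = c * \<phi> i x" "\<phi> i (sum g J) = (\<Sum>j\<in>J. \<phi> i (g j))"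
    if "i \<in> I" for i x y c and g :: "'a \<Rightarrow> MO2" and J
  proof -
    interpret Vector_Spaces.linear scale "(*)" "\<phi> i" by (rule lin[OF that])
    show "\<phi> i 0 = 0" "\<phi> i (x + y) = \<phi> i x + \<phi> i y" "\<phi> i (x - y) = \<phi> i x - \<phi> i y"
      "\<phi> i (scale c x) = c * \<phi> i x" "\<phi> i (sum g J) = (\<Sum>j\<in>J. \<phi> i (g j))"
      by (simp_all only: zero add diff scale sum)
  qed
  have W: "MO2.subspace W"
    unfolding W_def MO2.subspace_def
    using MO2.subspace_0[OF V] MO2.subspace_add[OF V] MO2.subspace_scale[OF V] by (auto simp: \<phi>)
  interpret Q: vectorspace class_ring "quotient_space V W"
    by (rule vectorspace_quotient_space[OF V W])
  let ?E = "\<lambda>i. coset W (e i)"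
  have \<phi>_sum: "\<phi> i (\<Sum>j\<in>I. scale (c j) (e j)) = c i" if "i \<in> I" for i c
  proof -
    have "\<phi> i (\<Sum>j\<in>I. scale (c j) (e j)) = (\<Sum>j\<in>I. if i = j then c j else 0)"
      unfolding \<phi>(5)[OF that] using that by (intro sum.cong refl) (simp add: \<phi> dual)
    also have "\<dots> = c i"
      using that \<open>finite I\<close> by (simp only: sum.delta' if_True)
    finally show ?thesis .
  qed
  have sum_V: "(\<Sum>j\<in>I. scale (c j) (e j)) \<in> V" for c
    using e by (intro MO2.subspace_sum[OF V] MO2.subspace_scale[OF V])
  have inj: "inj_on ?E I"
  proof
    fix i j assume ij: "i \<in> I" "j \<in> I" "?E i = ?E j"
    then have "\<phi> i (e i - e j) = 0"
      by (simp add: coset_eq_iff[OF W]) (simp add: W_def)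
    then show "i = j" using ij by (simp add: \<phi> dual split: if_splits)
  qed
  have lincomb: "Q.lincomb a (?E ` I) = coset W (\<Sum>i\<in>I. scale (a (?E i)) (e i))" for a
  proof -
    have "Q.lincomb a (?E ` I) =
        finsum (quotient_space V W) (\<lambda>i. a (?E i) \<odot>\<^bsub>quotient_space V W\<^esub> ?E i) I"
      unfolding Q.lincomb_def using e inj
      by (subst Q.finsum_reindex) (auto simp: smult_quotient_space[OF W] carrier_quotient_space
          MO2.subspace_scale[OF V])
    also have "\<dots> = coset W (\<Sum>i\<in>I. scale (a (?E i)) (e i))"
      unfolding smult_quotient_space[OF W]
      using e \<open>finite I\<close> by (intro finsum_quotient_space[OF V W]) (auto intro: MO2.subspace_scale[OF V])
    finally show ?thesis .
  qed
  have sub: "?E ` I \<subseteq> carrier (quotient_space V W)"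
    using e by (auto simp: carrier_quotient_space)
  have "Q.basis (?E ` I)"
    unfolding Q.basis_def
  proof (intro conjI)
    show "Q.lin_indpt (?E ` I)"
    proof (rule Q.finite_lin_indpt2)
      fix a assume "Q.lincomb a (?E ` I) = \<zero>\<^bsub>quotient_space V W\<^esub>"
      then have "(\<Sum>i\<in>I. scale (a (?E i)) (e i)) \<in> W"
        unfolding lincomb zero_quotient_space coset_eq_iff[OF W] by simp
      then have "a (?E i) = 0" if "i \<in> I" for i
        using that \<phi>_sum[OF that, of "\<lambda>i. a (?E i)"] by (simp add: W_def)
      then show "\<forall>X\<in>?E ` I. a X = \<zero>\<^bsub>class_ring\<^esub>" by simp
    qed (use \<open>finite I\<close> sub in auto)
    show "Q.gen_set (?E ` I)"
    proof (intro equalityI)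
      show "Q.span (?E ` I) \<subseteq> carrier (quotient_space V W)"
        using sub by (rule Q.span_is_subset2)
      show "carrier (quotient_space V W) \<subseteq> Q.span (?E ` I)"
      proof
        fix X assume "X \<in> carrier (quotient_space V W)"
        then obtain x where x: "x \<in> V" "X = coset W x" by (auto simp: carrier_quotient_space)
        \<comment> \<open>\<open>lincomb\<close> takes coefficients indexed by cosets, so the index
          is recovered by inverting the injective map \<open>?E\<close>.\<close>
        define a where "a = (\<lambda>Y. \<phi> (inv_into I ?E Y) x)"
        have "x - (\<Sum>i\<in>I. scale (\<phi> i x) (e i)) \<in> W"
          using x sum_V by (simp add: W_def \<phi>(3) \<phi>_sum MO2.subspace_diff[OF V])
        moreover have "(\<Sum>i\<in>I. scale (a (?E i)) (e i)) = (\<Sum>i\<in>I. scale (\<phi> i x) (e i))"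
          by (intro sum.cong refl) (simp add: a_def inv_into_f_f[OF inj])
        ultimately have "X = Q.lincomb a (?E ` I)"
          unfolding lincomb x(2) coset_eq_iff[OF W] by simp
        then show "X \<in> Q.span (?E ` I)"
          using sub \<open>finite I\<close> by (subst Q.finite_span) auto
      qed
    qed
  qed (rule sub)
  then have "Q.dim = card (?E ` I)"
    using \<open>finite I\<close> by (intro Q.dim_basis) auto
  then show ?thesis by (simp add: card_image[OF inj])
qed

section \<open>The generators and their coordinate functionals\<close>

text \<open>Coefficients are 0 or 1, so every element is reached from 0 by adding single
  monomials.\<close>

lemma MO2_induct [case_names zero add]:
  assumes "P 0" "\<And>n m x. P x \<Longrightarrow> P (v n m + x)"
  shows "P x"
proof (induction x rule: poly_mapping_plus_induct)
  case (add k c q)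
  then show ?case
    using assms(2)[of q "fst k" "snd k"] by (cases c) (simp_all add: v_def)
qed (rule assms(1))

lemma lookup_v: "Poly_Mapping.lookup (v n m) p = (if p = (n, m) then 1 else 0)"
  by (auto simp: v_def lookup_single when_def)

lemma v_eq_iff [simp]: "v n m = v k l \<longleftrightarrow> n = k \<and> m = l"
  by (metis lookup_v old.prod.inject zero_neq_one)

text \<open>Exponent pairs of the proposed generators, described by residues modulo 4 instead of
  parameters so that case distinctions become linear arithmetic.\<close>

definition gens :: "(nat \<times> nat) set" where
  "gens = {(n, m). n mod 4 = 0 \<and> m mod 4 = 2 \<or> n mod 4 = 2 \<and> m mod 4 = 0
    \<or> n = 0 \<and> m mod 4 \<in> {0, 3}}"

lemma G_eq: "G23 \<union> G01 = (\<lambda>(n, m). v n m) ` gens"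
proof (intro equalityI subsetI)
  fix x assume "x \<in> G23 \<union> G01"
  then consider a b where "x = v (4 * a) (2 + 4 * b)" | a where "x = v 0 (3 + 4 * a)"
    | a b where "x = v (4 * a + 2) (4 * b)" | a where "x = v 0 (4 * a)"
    unfolding G23_def G01_def by blast
  then obtain n m where x: "x = v n m" and "(n, m) \<in> gens"
  proof cases
    case (1 a b)
    have "(2 + 4 * b) mod 4 = 2" by presburger
    then show ?thesis using that[OF 1] by (simp add: gens_def)
  next
    case (2 a)
    have "(3 + 4 * a) mod 4 = 3" by presburger
    then show ?thesis using that[OF 2] by (simp add: gens_def)
  next
    case (3 a b)
    have "(4 * a + 2) mod 4 = 2" by presburger
    then show ?thesis using that[OF 3] by (simp add: gens_def)
  next
    case (4 a)
    then show ?thesis using that[OF 4] by (simp add: gens_def)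
  qed
  then show "x \<in> (\<lambda>(n, m). v n m) ` gens" by force
next
  fix x assume "x \<in> (\<lambda>(n, m). v n m) ` gens"
  then obtain n m where x: "x = v n m" and "(n, m) \<in> gens" by auto
  then consider "n mod 4 = 0" "m mod 4 = 2" | "n mod 4 = 2" "m mod 4 = 0"
    | "n = 0" "m mod 4 = 0" | "n = 0" "m mod 4 = 3"
    unfolding gens_def by auto
  then show "x \<in> G23 \<union> G01"
  proof cases
    case 1
    then have "n = 4 * (n div 4)" "m = 2 + 4 * (m div 4)" by presburger+
    then obtain a b where "n = 4 * a" "m = 2 + 4 * b" by blast
    then show ?thesis unfolding x G23_def by blast
  next
    case 2
    then have "n = 4 * (n div 4) + 2" "m = 4 * (m div 4)" by presburger+
    then obtain a b where "n = 4 * a + 2" "m = 4 * b" by blast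
    then show ?thesis unfolding x G01_def by blast
  next
    case 3
    then have "m = 4 * (m div 4)" by presburger
    then obtain a where "m = 4 * a" by blast
    then show ?thesis unfolding x G01_def 3 by blast
  next
    case 4
    then have "m = 3 + 4 * (m div 4)" by presburger
    then obtain a where "m = 3 + 4 * a" by blast
    then show ?thesis unfolding x G23_def 4 by blast
  qed
qed

text \<open>The second exponent is 2 or 3 modulo 4 in \<open>G23\<close> and 0 modulo 4 in
  \<open>G01\<close>.\<close>

lemma G_disjoint: "G23 \<inter> G01 = {}"
  by (auto simp: G23_def G01_def; presburger)

text \<open>
  The second term is forced by \<open>act (Sq 2) (v 0 m) = v 2 m + v 0 (m + 1)\<close> for \<open>m \<equiv> 2\<close> modulo 4.
\<close>

definition coord :: "nat \<times> nat \<Rightarrow> MO2 \<Rightarrow> bit" where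
  "coord p x = Poly_Mapping.lookup x p +
    (if fst p = 0 \<and> snd p mod 4 = 3 then Poly_Mapping.lookup x (2, snd p - 1) else 0)"

lemma coord_0 [simp]: "coord p 0 = 0"
  by (simp add: coord_def)

lemma coord_add [simp]: "coord p (x + y) = coord p x + coord p y"
proof -
  have "(a + b) + (if P then c + d else 0) = (a + (if P then c else 0)) + (b + (if P then d else 0))"
    for P and a b c d :: "'a :: comm_monoid_add"
    by (simp add: ac_simps)
  then show ?thesis unfolding coord_def lookup_add .
qed

lemma coord_scale [simp]: "coord p (scale c x) = c * coord p x"
proof -
  have "c * a + (if P then c * b else 0) = c * (a + (if P then b else 0))"
    for P and a b c :: "'a :: semiring_0"
    by (simp add: distrib_left)
  then show ?thesis unfolding coord_def lookup_scale .
qed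

lemma linear_coord: "Vector_Spaces.linear scale (*) (coord p)"
  by unfold_locales (simp_all only: coord_add coord_scale distrib_left distrib_right mult.assoc
      mult_1_left MO2.scale_right_distrib MO2.scale_left_distrib MO2.scale_scale MO2.scale_one)

lemma coord_v:
  "coord (k, l) (v n m) = of_bool (k = n \<and> l = m \<or> k = 0 \<and> l = m + 1 \<and> n = 2 \<and> m mod 4 = 2)"
proof (cases "k = 0 \<and> l mod 4 = 3")
  case True
  \<comment> \<open>Here \<open>l\<close> is positive, so the truncated subtraction in
    \<open>coord\<close> is exact.\<close>
  then have "l - 1 = m \<longleftrightarrow> l = m + 1" "l = m + 1 \<Longrightarrow> m mod 4 = 2" by presburger+
  with True show ?thesis by (auto simp: coord_def lookup_v)
next
  case False
  then have "\<not> (k = 0 \<and> l = m + 1 \<and> m mod 4 = 2)" by presburger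
  with False show ?thesis by (auto simp: coord_def lookup_v)
qed

text \<open>The correction term of \<open>coord\<close> reads only coefficients at
  \<open>(2, m)\<close> with \<open>m\<close> congruent to 2 modulo 4, and no such pair is in
  \<open>gens\<close>. The functionals are therefore dual to the generators.\<close>

lemma coord_gen:
  assumes "p \<in> gens" "(n, m) \<in> gens"
  shows "coord p (v n m) = (if p = (n, m) then 1 else 0)"
  using assms by (cases p) (auto simp: coord_v gens_def)

section \<open>The decomposables\<close>

lemma of_nat_bit: "(of_nat k :: bit) = of_bool (odd k)"
  by (induction k) simp_all

text \<open>A case of Lucas's theorem: the parity is the second binary digit of
  \<open>k\<close>.\<close>

lemma odd_choose_two: "odd (k choose 2) \<longleftrightarrow> k mod 4 \<in> {2, 3}"
proof -
  have "odd (k * (k - 1) div 2) \<longleftrightarrow> k mod 4 \<in> {2, 3}"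
  proof -
    define q where "q = k div 4"
    consider "k mod 4 = 0" | "k mod 4 = 1" | "k mod 4 = 2" | "k mod 4 = 3" by linarith
    then show ?thesis
    proof cases
      case 1
      then have "k = 4 * q" unfolding q_def by presburger
      then have "k * (k - 1) div 2 = 2 * (q * (k - 1))" by simp
      then show ?thesis using 1 by simp
    next
      case 2
      then have "k = 4 * q + 1" unfolding q_def by presburger
      then have "k * (k - 1) div 2 = 2 * (q * k)" by simp
      then show ?thesis using 2 by simp
    next
      case 3
      then have "k = 4 * q + 2" unfolding q_def by presburger
      then have "k * (k - 1) = 2 * ((2 * q + 1) * (4 * q + 1))" by simp
      then show ?thesis using 3 by simp
    next
      case 4
      then have "k = 4 * q + 3" unfolding q_def by presburger
      then have "k * (k - 1) = 2 * ((4 * q + 3) * (2 * q + 1))" by simp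
      then show ?thesis using 4 by simp
    qed
  qed
  then show ?thesis by (simp add: choose_two)
qed

section \<open>The augmentation of the Steenrod algebra\<close>

lift_definition augmentation :: "steenrod \<Rightarrow> bit" is free_augmentation
  by (metis free_augmentation_diff free_augmentation_ideal eq_iff_diff_eq_0)

lemma augmentation_ring_hom [simp]:
  "augmentation 0 = 0" "augmentation 1 = 1"
  "augmentation (a + b) = augmentation a + augmentation b"
  "augmentation (a * b) = augmentation a * augmentation b"
  by (transfer; simp)+

lemma augmentation_Sq: "augmentation (Sq i) = of_bool (i = 0)"
  unfolding Sq_def by (simp add: augmentation.abs_eq free_augmentation_Sq)

lemma augmentation_A1_plus:
  assumes "a \<in> A1_plus"
  shows "augmentation a = 0"
proof -
  from assms obtain p where "a = steenrod_class p" "\<forall>w\<in>Poly_Mapping.keys p. 0 < word_degree w"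
    by (auto simp: A1_plus_def)
  then show ?thesis
    by (auto simp: augmentation.abs_eq free_augmentation_def intro!: sum.neutral)
qed

lemma Sq_in_A1_plus: "Sq i \<in> A1 \<Longrightarrow> 0 < i \<Longrightarrow> Sq i \<in> A1_plus"
  unfolding A1_plus_def Sq_def by (auto intro!: exI[of _ "free_Sq i"] simp: free_Sq_def)

section \<open>The action on monomials and the coordinate functionals\<close>

locale thom_module =
  fixes act :: "steenrod \<Rightarrow> MO2 \<Rightarrow> MO2"
  assumes module: "A1_module act"
    and Sq1_v: "\<And>n m. act (Sq 1) (v n m) = scale (of_nat (n + m + 1)) (v (n + 1) m)"
    and Sq2_v: "\<And>n m. act (Sq 2) (v n m) =
      scale (of_nat ((n + m + 1) choose 2)) (v (n + 2) m) + scale (of_nat (m + 1)) (v n (m + 1))"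
begin

lemma act_add_right: "a \<in> A1 \<Longrightarrow> act a (x + y) = act a x + act a y"
  and act_add_left: "a \<in> A1 \<Longrightarrow> b \<in> A1 \<Longrightarrow> act (a + b) x = act a x + act b x"
  and act_mult: "a \<in> A1 \<Longrightarrow> b \<in> A1 \<Longrightarrow> act (a * b) x = act a (act b x)"
  and act_one: "act 1 x = x"
  using module unfolding A1_module_def by blast+

lemma act_zero_right: "a \<in> A1 \<Longrightarrow> act a 0 = 0"
  using act_add_right[of a 0 0] by simp

lemma act_zero_left: "act 0 x = 0"
  using act_add_left[OF A1.zero A1.zero, of x] by simp

lemma Sq1_v': "act (Sq 1) (v n m) = (if even (n + m) then v (n + 1) m else 0)"
  unfolding Sq1_v of_nat_bit by simp

lemma Sq2_v': "act (Sq 2) (v n m) =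
    (if (n + m) mod 4 \<in> {1, 2} then v (n + 2) m else 0) + (if even m then v n (m + 1) else 0)"
proof -
  have "(n + m + 1) mod 4 \<in> {2, 3} \<longleftrightarrow> (n + m) mod 4 \<in> {1, 2}" by (simp; presburger)
  then show ?thesis
    unfolding Sq2_v of_nat_bit odd_choose_two by simp
qed

text \<open>A nonzero \<open>Sq 1\<close> image of a monomial has odd exponent sum and positive
  first exponent, which no generator has. The first term of \<open>Sq 2\<close> has exponent sum 3
  or 0 modulo 4 and positive first exponent, and the second has odd second exponent. Neither meets a
  generator except when \<open>Sq 2\<close> is applied to \<open>v 0 m\<close> with \<open>m\<close>
  congruent to 2 modulo 4, where the correction term of \<open>coord\<close> produces a
  cancellation.\<close>

lemma coord_Sq:
  assumes "p \<in> gens"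
  shows "coord p (act (Sq 1) x) = 0" "coord p (act (Sq 2) x) = 0"
proof -
  obtain k l where p: "p = (k, l)" by fastforce
  have kl: "even k \<and> (k + l) mod 4 = 2 \<or> k = 0 \<and> l mod 4 \<in> {0, 3}"
  proof -
    have "even k \<and> (k + l) mod 4 = 2"
      if "k mod 4 = 0 \<and> l mod 4 = 2 \<or> k mod 4 = 2 \<and> l mod 4 = 0"
      using that by presburger
    then show ?thesis using assms unfolding p gens_def by auto
  qed
  have Sq1: "coord p (act (Sq 1) (v n m)) = 0" for n m
  proof (cases "even (n + m)")
    case True
    moreover have "even k \<and> even (k + l) \<or> k = 0"
      using kl by presburger
    ultimately have "\<not> (k = n + 1 \<and> l = m)" by auto
    moreover have "\<not> (n + 1 = 2 \<and> m mod 4 = 2)" using True by presburger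
    ultimately show ?thesis using True unfolding Sq1_v' p by (simp add: coord_v)
  qed (simp add: Sq1_v' del: One_nat_def)
  have Sq2: "coord p (act (Sq 2) (v n m)) = 0" for n m
  proof -
    \<comment> \<open>The only situation in which the terms of \<open>Sq 2\<close> have a nonzero
      coordinate; both coordinates are then 1 and their sum vanishes.\<close>
    let ?Z = "k = 0 \<and> n = 0 \<and> l = m + 1 \<and> m mod 4 = 2"
    have "(n + m) mod 4 = 0" if "k = n + 2 \<and> l = m"
    proof -
      have "(k + l) mod 4 = 2" using that kl by auto
      then have "(n + m + 2) mod 4 = 2" using that by (simp add: algebra_simps)
      then show ?thesis by presburger
    qed
    then have Z1: "coord p (if (n + m) mod 4 \<in> {1, 2} then v (n + 2) m else 0) = of_bool ?Z"
      unfolding p by (auto simp: coord_v)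
    have "k = n \<and> l = m + 1 \<longleftrightarrow> ?Z" if "even m"
    proof
      assume *: "k = n \<and> l = m + 1"
      have "odd l" using * that by simp
      moreover have "even l" if "even k \<and> (k + l) mod 4 = 2 \<or> l mod 4 = 0"
        using that by presburger
      ultimately have "k = 0" "l mod 4 = 3" using kl by auto
      moreover from this have "m mod 4 = 2" using * by presburger
      ultimately show ?Z using * by simp
    qed simp
    moreover have "odd m" if "(m + 1) mod 4 = 2"
      using that by presburger
    moreover have "even m" if "m mod 4 = 2"
      using that by presburger
    ultimately have "coord p (if even m then v n (m + 1) else 0) = of_bool ?Z"
      unfolding p by (auto simp: coord_v)
    then show ?thesis
      unfolding Sq2_v' coord_add Z1 by simp
  qed
  show "coord p (act (Sq 1) x) = 0"
    by (induction x rule: MO2_induct) (simp_all add: act_zero_right act_add_right A1.Sq1 Sq1 del: One_nat_def)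
  show "coord p (act (Sq 2) x) = 0"
    by (induction x rule: MO2_induct) (simp_all add: act_zero_right act_add_right A1.Sq2 Sq2)
qed

text \<open>Both sides respect sums and products in \<open>a\<close>, so the claim reduces to
  \<open>Sq 1\<close> and \<open>Sq 2\<close>, where both vanish.\<close>

lemma coord_act:
  assumes "p \<in> gens" "a \<in> A1"
  shows "coord p (act a x) = augmentation a * coord p x"
  using assms(2)
proof (induction arbitrary: x)
  case Sq1
  then show ?case using coord_Sq(1)[OF assms(1)] by (simp add: augmentation_Sq del: One_nat_def)
next
  case Sq2
  then show ?case using coord_Sq(2)[OF assms(1)] by (simp add: augmentation_Sq)
next
  case (add a b)
  then show ?case by (simp only: act_add_left coord_add augmentation_ring_hom distrib_right)
next
  case (mult a b)
  then show ?case by (simp only: act_mult augmentation_ring_hom mult.assoc)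
qed (simp_all add: act_zero_left act_one)

text \<open>Shared by two arguments: \<open>N\<close> may be a submodule, where the bound on the
  degree in the premises is what induction supplies, or the span of generators and decomposables,
  where all images of \<open>Sq 1\<close> and \<open>Sq 2\<close> are present. Every monomial
  outside \<open>gens\<close> is such an image, up to a monomial of the same degree already known to
  lie in \<open>N\<close>.\<close>

lemma v_mem:
  assumes N: "MO2.subspace N" and gens: "\<And>k l. (k, l) \<in> gens \<Longrightarrow> v k l \<in> N"
    and Sq: "\<And>k l. k + 2 * l < n + 2 * m \<Longrightarrow> act (Sq 1) (v k l) \<in> N"
      "\<And>k l. k + 2 * l < n + 2 * m \<Longrightarrow> act (Sq 2) (v k l) \<in> N"
  shows "v n m \<in> N"
proof -
  have cancel: "y \<in> N" if "x \<in> N" "x + y \<in> N" for x y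
  proof -
    show ?thesis using MO2.subspace_add[OF N that] by (simp flip: add.assoc)
  qed
  \<comment> \<open>\<open>v k l\<close> is exactly \<open>act (Sq 1) (v (k - 1) l)\<close>, since
    the exponent sum there is even. The bound on the degree is not strict because the lemma is also
    applied in the degree of \<open>v n m\<close> itself.\<close>
  have odd_sum: "v k l \<in> N" if "0 < k" "odd (k + l)" "k + 2 * l \<le> n + 2 * m" for k l
    using Sq(1)[of "k - 1" l] that unfolding Sq1_v' by (auto split: if_splits)
  consider "(n, m) \<in> gens" | "0 < n" "odd (n + m)" | "odd n" "odd m" "(n + m) mod 4 = 0"
    | "odd n" "odd m" "(n + m) mod 4 = 2" | "n = 0" "m mod 4 = 1"
    | "4 \<le> n" "even n" "even m" "(n + m) mod 4 = 0" | "n = 2" "m mod 4 = 2"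
  proof -
    consider "odd (n + m)" "n = 0" | "odd (n + m)" "0 < n" | "odd n" "odd m" | "even n" "even m"
      by auto
    then show thesis
    proof cases
      case 1
      then have "m mod 4 = 1 \<or> m mod 4 = 3" by presburger
      then show ?thesis using 1 that(1,5) by (auto simp: gens_def)
    next
      case 2
      then show ?thesis using that(2) by simp
    next
      case 3
      then have "(n + m) mod 4 = 0 \<or> (n + m) mod 4 = 2" by presburger
      then show ?thesis using 3 that(3,4) by auto
    next
      case 4
      show ?thesis
      proof (cases "n mod 4 = m mod 4")
        case True
        then have "(n + m) mod 4 = 0" "n < 4 \<Longrightarrow> n = 0 \<and> m mod 4 = 0 \<or> n = 2 \<and> m mod 4 = 2"
          using 4 by presburger+
        then show ?thesis using 4 that(1,6,7) by (cases "n < 4") (auto simp: gens_def)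
      next
        case False
        then have "n mod 4 = 0 \<and> m mod 4 = 2 \<or> n mod 4 = 2 \<and> m mod 4 = 0"
          using 4 by presburger
        then show ?thesis using that(1) by (auto simp: gens_def)
      qed
    qed
  qed
  then show ?thesis
  proof cases
    case 1
    then show ?thesis by (rule gens)
  next
    case 2
    then show ?thesis by (rule odd_sum) simp
  next
    case 3
    \<comment> \<open>Only the second term of \<open>Sq 2\<close> on \<open>v n l\<close> survives,
      and it is \<open>v n m\<close>.\<close>
    then obtain l where "m = Suc l" by (cases m) auto
    moreover from this have "(n + l) mod 4 = 3" "even l" using 3 by presburger+
    ultimately show ?thesis using Sq(2)[of n l] unfolding Sq2_v' by simp
  next
    case 4
    \<comment> \<open>Both terms of \<open>Sq 2\<close> on \<open>v n l\<close> survive, but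
      \<open>v (n + 2) l\<close> has odd exponent sum and is covered by
      \<open>odd_sum\<close>.\<close>
    then obtain l where l: "m = Suc l" by (cases m) auto
    moreover from this have "(n + l) mod 4 = 1" "even l" using 4 by presburger+
    ultimately have "v (n + 2) l + v n m \<in> N" using Sq(2)[of n l] unfolding Sq2_v' by simp
    moreover have "v (n + 2) l \<in> N" using l 4 by (intro odd_sum) auto
    ultimately show ?thesis by (rule cancel[rotated])
  next
    case 5
    then obtain l where "m = Suc l" by (cases m) auto
    moreover from this have "l mod 4 = 0" "even l" using 5 by presburger+
    ultimately show ?thesis using Sq(2)[of n l] 5 unfolding Sq2_v' by simp
  next
    case 6
    \<comment> \<open>\<open>v n m\<close> is now the first term of \<open>Sq 2\<close> on
      \<open>v k m\<close>. The second, \<open>v k (m + 1)\<close>, has odd exponent sum, and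
      \<open>4 \<le> n\<close> gives the positive first exponent that \<open>odd_sum\<close>
      demands.\<close>
    then obtain k where k: "n = k + 2" by (metis add.commute le_Suc_ex numeral_Bit0 add.assoc)
    then have "(k + m) mod 4 = 2" using 6 by presburger
    then have "v k (m + 1) + v n m \<in> N"
      using Sq(2)[of k m] 6 k unfolding Sq2_v' by (simp add: add.commute)
    moreover have "v k (m + 1) \<in> N" using k 6 by (intro odd_sum) auto
    ultimately show ?thesis by (rule cancel[rotated])
  next
    case 7
    \<comment> \<open>With \<open>n = 2\<close> the companion term is \<open>v 0 (m + 1)\<close>,
      out of reach of \<open>odd_sum\<close> but itself a generator.\<close>
    then have "even m" "(m + 1) mod 4 = 3" by presburger+
    then have "v 0 (m + 1) + v n m \<in> N" "v 0 (m + 1) \<in> N"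
      using Sq(2)[of 0 m] 7 gens[of 0 "m + 1"] unfolding Sq2_v'
      by (simp_all add: add.commute gens_def numeral_2_eq_2)
    then show ?thesis by (rule cancel[rotated])
  qed
qed

text \<open>Decomposables are killed by \<open>coord_act\<close>, as their operators have
  augmentation 0. Conversely, \<open>v_mem\<close> writes any \<open>x\<close> as a combination
  \<open>y\<close> of generators plus a decomposable; if all coordinates of \<open>x\<close> vanish,
  so do those of \<open>y\<close>, which forces \<open>y = 0\<close>.\<close>

lemma A1_plus_M_eq: "A1_plus_M act = {x. \<forall>p\<in>gens. coord p x = 0}"
proof (intro equalityI subsetI)
  show sub: "x \<in> {x. \<forall>p\<in>gens. coord p x = 0}" if "x \<in> A1_plus_M act" for x
  proof -
    have "A1_plus_M act \<subseteq> {x. \<forall>p\<in>gens. coord p x = 0}"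
      unfolding A1_plus_M_def
    proof (rule MO2.span_minimal)
      show "{act a x |a x. a \<in> A1_plus} \<subseteq> {x. \<forall>p\<in>gens. coord p x = 0}"
      proof clarify
        fix a x k l assume "a \<in> A1_plus" "(k, l) \<in> gens"
        moreover from this have "a \<in> A1" by (simp add: A1_plus_def)
        ultimately show "coord (k, l) (act a x) = 0"
          by (simp only: coord_act augmentation_A1_plus mult_zero_left)
      qed
      show "MO2.subspace {x. \<forall>p\<in>gens. coord p x = 0}"
        by (auto simp: MO2.subspace_def)
    qed
    then show ?thesis using that by blast
  qed
  fix x assume x: "x \<in> {x. \<forall>p\<in>gens. coord p x = 0}"
  let ?G = "(\<lambda>(n, m). v n m) ` gens"
  let ?A = "{act a x |a x. a \<in> A1_plus}"
  have v: "v n m \<in> MO2.span (?G \<union> ?A)" for n m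
  proof (rule v_mem)
    show "v k l \<in> MO2.span (?G \<union> ?A)" if "(k, l) \<in> gens" for k l
      using that by (intro MO2.span_base UnI1) force
    have "act (Sq 1) y \<in> ?A" "act (Sq 2) y \<in> ?A" for y
      using Sq_in_A1_plus[OF A1.Sq1] Sq_in_A1_plus[OF A1.Sq2] by auto
    then show "act (Sq 1) y \<in> MO2.span (?G \<union> ?A)" "act (Sq 2) y \<in> MO2.span (?G \<union> ?A)" for y
      by (simp_all add: MO2.span_base del: One_nat_def)
  qed simp
  have "x \<in> MO2.span (?G \<union> ?A)"
  proof (induction x rule: MO2_induct)
    case (add n m x)
    then show ?case by (rule MO2.span_add[OF v])
  qed (rule MO2.span_zero)
  then obtain y z where xyz: "x = y + z" and y: "y \<in> MO2.span ?G" and z: "z \<in> A1_plus_M act"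
    unfolding MO2.span_Un A1_plus_M_def by auto
  have supp: "Poly_Mapping.lookup y q = 0" if "q \<notin> gens" for q
  proof -
    have "MO2.span ?G \<subseteq> {y. Poly_Mapping.lookup y q = 0}"
      using that by (intro MO2.span_minimal) (auto simp: MO2.subspace_def lookup_add lookup_v)
    with y show ?thesis by blast
  qed
  have "Poly_Mapping.lookup y q = 0" for q
  proof (cases "q \<in> gens")
    case True
    have "coord q x = 0" "coord q z = 0" using x sub[OF z] True by blast+
    moreover have "coord q x = coord q y + coord q z" unfolding xyz by (rule coord_add)
    ultimately have "coord q y = 0" by (simp only: add_0_right)
    \<comment> \<open>The correction term reads a coefficient outside \<open>gens\<close>, so on
      \<open>y\<close> the functional is the plain coefficient.\<close>
    moreover have "Poly_Mapping.lookup y (2, snd q - 1) = 0" if "snd q mod 4 = 3"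
    proof -
      have "(snd q - 1) mod 4 = 2"
        using that by (cases "snd q") (auto simp: mod_Suc split: if_splits)
      then show ?thesis by (intro supp) (simp add: gens_def)
    qed
    then have "coord q y = Poly_Mapping.lookup y q" unfolding coord_def by simp
    ultimately show ?thesis by simp
  qed (rule supp)
  then have "y = 0" by (intro poly_mapping_eqI) simp
  with xyz z show "x \<in> A1_plus_M act" by simp
qed

end

section \<open>Generation and Hilbert series\<close>

lemma M_int_support:
  assumes "x \<in> M_int h" "Poly_Mapping.lookup x (n, m) \<noteq> 0"
  shows "n + 2 * m = h"
proof (rule ccontr)
  assume *: "n + 2 * m \<noteq> h"
  have "M_int h \<subseteq> {x. Poly_Mapping.lookup x (n, m) = 0}"
    unfolding M_int_def using *
    by (intro MO2.span_minimal) (auto simp: MO2.subspace_def lookup_add lookup_v)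
  with assms show False by auto
qed

text \<open>The functionals are homogeneous: the correction term sits at \<open>(2, l - 1)\<close>,
  which has the same internal degree as \<open>(0, l)\<close>.\<close>

lemma coord_M_int:
  assumes "x \<in> M_int h" "k + 2 * l \<noteq> h"
  shows "coord (k, l) x = 0"
proof -
  have "2 + 2 * (l - 1) \<noteq> h" if "k = 0" "l mod 4 = 3"
  proof -
    have "2 + 2 * (l - 1) = 2 * l" using that by (cases l) auto
    then show ?thesis using assms(2) that by simp
  qed
  then have "Poly_Mapping.lookup x (2, l - 1) = 0" if "k = 0" "l mod 4 = 3"
    using that M_int_support[OF assms(1)] by blast
  moreover have "Poly_Mapping.lookup x (k, l) = 0"
    using assms M_int_support by blast
  ultimately show ?thesis unfolding coord_def by simp
qed

context thom_module
begin

text \<open>Scalars are 0 or 1, so a submodule is a subspace, and \<open>v_mem\<close> drives a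
  strong induction on the internal degree.\<close>

lemma submodule_UNIV:
  assumes N: "A1_submodule act N" and G: "G23 \<union> G01 \<subseteq> N"
  shows "N = UNIV"
proof -
  have sub: "MO2.subspace N"
    unfolding MO2.subspace_def
  proof (intro conjI ballI allI)
    show "scale c x \<in> N" if "x \<in> N" for c x
      using N that by (cases c) (simp_all add: A1_submodule_def)
  qed (use N in \<open>auto simp: A1_submodule_def\<close>)
  have act: "act a x \<in> N" if "a \<in> A1" "x \<in> N" for a x
    using N that by (auto simp: A1_submodule_def)
  have v: "v n m \<in> N" for n m
  proof (induction "n + 2 * m" arbitrary: n m rule: less_induct)
    case less
    show ?case
    proof (rule v_mem[OF sub])
      show "v k l \<in> N" if "(k, l) \<in> gens" for k l
        using that G unfolding G_eq by force
    qed (intro act A1.Sq1 A1.Sq2 less; assumption)+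
  qed
  have "x \<in> N" for x
    by (induction x rule: MO2_induct) (simp_all add: MO2.subspace_0 MO2.subspace_add sub v)
  then show ?thesis by blast
qed

lemma coord_kernel_submodule: "p \<in> gens \<Longrightarrow> A1_submodule act {x. coord p x = 0}"
  by (simp add: A1_submodule_def coord_act)

lemma minimal_generating_set: "minimal_homogeneous_generating_set act (G23 \<union> G01)"
  unfolding minimal_homogeneous_generating_set_def
proof (intro conjI ballI)
  fix g assume g: "g \<in> G23 \<union> G01"
  then obtain n m where nm: "g = v n m" "(n, m) \<in> gens" unfolding G_eq by auto
  have "g \<in> M_int (n + 2 * m)"
    unfolding M_int_def nm by (intro MO2.span_base) blast
  then show "\<exists>h. g \<in> M_int h" ..
  show "\<not> A1_generates act (G23 \<union> G01 - {g})"
  proof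
    assume "A1_generates act (G23 \<union> G01 - {g})"
    \<comment> \<open>By duality all other generators lie in this kernel, a submodule that misses
      \<open>g\<close>.\<close>
    moreover have "A1_submodule act hull (G23 \<union> G01 - {g}) \<subseteq> {x. coord (n, m) x = 0}"
      unfolding G_eq nm using nm(2)
      by (intro hull_minimal coord_kernel_submodule) (auto simp: coord_gen)
    ultimately have "coord (n, m) g = 0" unfolding A1_generates_def by blast
    then show False using nm(2) by (simp add: nm(1) coord_gen)
  qed
next
  show "A1_generates act (G23 \<union> G01)"
    unfolding A1_generates_def hull_def using submodule_UNIV by auto
qed

text \<open>The generators of degree \<open>h\<close> and their coordinates form the dual pair.
  Coordinates of other degrees vanish on \<open>M_int h\<close>, so the common kernel is cut out by
  this finite family alone.\<close>

lemma dim_Q_int: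
  "vectorspace.dim class_ring (Q_int act h) = card {(n, m) \<in> gens. n + 2 * m = h}"
  unfolding Q_int_def
proof (rule dim_quotient_space)
  let ?I = "{(n, m) \<in> gens. n + 2 * m = h}"
  show "MO2.subspace (M_int h)" unfolding M_int_def by simp
  show "finite ?I" by (rule finite_subset[of _ "{..h} \<times> {..h}"]) auto
  show "case_prod v p \<in> M_int h" if "p \<in> ?I" for p
    unfolding M_int_def using that by (intro MO2.span_base) auto
  show "Vector_Spaces.linear scale (*) (coord p)" for p by (rule linear_coord)
  show "coord p (case_prod v q) = (if p = q then 1 else 0)" if "p \<in> ?I" "q \<in> ?I" for p q
  proof -
    have "p \<in> gens" "(fst q, snd q) \<in> gens" using that by auto
    from coord_gen[OF this] show ?thesis by (simp only: case_prod_unfold prod.collapse)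
  qed
  show "A1_plus_M act \<inter> M_int h = {x \<in> M_int h. \<forall>p\<in>?I. coord p x = 0}"
  proof -
    have "coord p x = 0" if "x \<in> M_int h" "\<forall>p\<in>?I. coord p x = 0" "p \<in> gens" for p x
      using that coord_M_int[of x h "fst p" "snd p"]
      by (cases p; cases "fst p + 2 * snd p = h") auto
    moreover have "?I \<subseteq> gens" by auto
    ultimately show ?thesis unfolding A1_plus_M_eq by blast
  qed
qed

text \<open>The shift is the degree 2 of the Thom class.\<close>

lemma Q_coh_Suc_Suc: "Q_coh act (h + 2) = Q_int act h"
  by (simp add: Q_coh_def Q_int_def M_coh_def M_int_def)

lemma dim_Q_coh_low:
  assumes "d < 2"
  shows "vectorspace.dim class_ring (Q_coh act d) = 0"
proof -
  have "{v n m |n m. n + 2 * m + 2 = d} = {}" using assms by auto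
  then have "M_coh d = {0}" by (simp only: M_coh_def MO2.span_empty)
  moreover have "0 \<in> A1_plus_M act" by (simp add: A1_plus_M_eq)
  ultimately show ?thesis
    unfolding Q_coh_def
    \<comment> \<open>Both spaces are \<open>{0}\<close>, so the empty dual family suffices.\<close>
    by (subst dim_quotient_space[where I = "{}"]) auto
qed

end

section \<open>Counting the generators in each degree\<close>

lemma card_mod_class:
  fixes c k N :: nat
  assumes "0 < N" "c < N"
  shows "card {m. m \<le> k \<and> m mod N = c} = (k + N - c) div N"
proof -
  \<comment> \<open>Adding \<open>N\<close> before subtracting \<open>c\<close> keeps the natural
    subtraction exact; for \<open>k < c\<close> the bound is 0, as it should be.\<close>
  have "{m. m \<le> k \<and> m mod N = c} = (\<lambda>j. N * j + c) ` {..<(k + N - c) div N}"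
  proof (intro equalityI subsetI)
    fix m assume "m \<in> {m. m \<le> k \<and> m mod N = c}"
    then have m: "m \<le> k" "m = N * (m div N) + c" by auto
    then have "(m div N + 1) * N \<le> k + N - c" by (simp add: algebra_simps)
    then have "m div N + 1 \<le> (k + N - c) div N" using assms by (simp add: less_eq_div_iff_mult_less_eq)
    then show "m \<in> (\<lambda>j. N * j + c) ` {..<(k + N - c) div N}"
      using m(2) by (intro image_eqI[of _ _ "m div N"]) auto
  next
    fix m assume "m \<in> (\<lambda>j. N * j + c) ` {..<(k + N - c) div N}"
    then obtain j where j: "m = N * j + c" "j < (k + N - c) div N" by blast
    then have "j + 1 \<le> (k + N - c) div N" by simp
    then have "(j + 1) * N \<le> k + N - c" using assms by (simp add: less_eq_div_iff_mult_less_eq)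
    then show "m \<in> {m. m \<le> k \<and> m mod N = c}" using j(1) assms by (simp add: algebra_simps)
  qed
  moreover have "inj_on (\<lambda>j. N * j + c) {..<(k + N - c) div N}"
    using assms by (auto simp: inj_on_def)
  ultimately show ?thesis by (simp add: card_image)
qed

text \<open>First exponents of generators are even, so odd degrees are empty. For
  \<open>h = 2 * k\<close> a generator is determined by \<open>m\<close>, with
  \<open>n = 2 * (k - m)\<close>.\<close>

lemma card_gens_degree:
  "card {(n, m) \<in> gens. n + 2 * m = h} =
    (if even h then h div 8 + 1 + of_bool (h mod 8 = 6) else 0)"
proof (cases "even h")
  case False
  have "even (n + 2 * m)" if "(n, m) \<in> gens" for n m
  proof -
    have "even n" if "n mod 4 = 0 \<or> n mod 4 = 2" using that by presburger
    then show ?thesis using \<open>(n, m) \<in> gens\<close> by (auto simp: gens_def)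
  qed
  then have "{(n, m) \<in> gens. n + 2 * m = h} = {}" using False by auto
  then show ?thesis using False by (simp only: card.empty if_False)
next
  case True
  then obtain k where h: "h = 2 * k" by blast
  \<comment> \<open>For even \<open>m\<close>, the residue of \<open>2 * (k - m)\<close> modulo 4 is
    fixed by the parity of \<open>k\<close>, which selects one two-parameter family, with
    \<open>m\<close> congruent to \<open>c\<close>. \<open>T\<close> collects the remaining
    generators, those with \<open>n = 0\<close>.\<close>
  define c where "c = (if even k then 2 else 0 :: nat)"
  define S where "S = {m. m \<le> k \<and> m mod 4 = c}"
  define T where "T = {m. m = k \<and> k mod 4 \<in> {0, 3}}"
  have le: "m \<le> k" if "m \<in> S \<union> T" for m using that by (auto simp: S_def T_def)
  have 1: "(2 * (k - m), m) \<in> gens \<longleftrightarrow> m \<in> S \<union> T" if "m \<le> k" for m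
  proof -
    obtain a where a: "k = m + a" using \<open>m \<le> k\<close> by (metis le_Suc_ex)
    have mod4: "2 * a mod 4 = 0 \<longleftrightarrow> even a" "2 * a mod 4 = 2 \<longleftrightarrow> odd a"
      by presburger+
    have "even a \<longleftrightarrow> even k" if "m mod 4 = 0 \<or> m mod 4 = 2"
    proof -
      have "even m" using that by presburger
      then show ?thesis by (simp add: a)
    qed
    moreover have "(2 * (k - m), m) \<in> gens \<longleftrightarrow>
        even a \<and> m mod 4 = 2 \<or> odd a \<and> m mod 4 = 0 \<or> a = 0 \<and> m mod 4 \<in> {0, 3}"
      by (simp add: gens_def a mod4)
    ultimately have "(2 * (k - m), m) \<in> gens \<longleftrightarrow>
        even k \<and> m mod 4 = 2 \<or> odd k \<and> m mod 4 = 0 \<or> m = k \<and> k mod 4 \<in> {0, 3}"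
      using a by auto
    then show ?thesis
      using \<open>m \<le> k\<close> by (cases "even k") (auto simp: S_def T_def c_def)
  qed
  have "{(n, m) \<in> gens. n + 2 * m = h} = (\<lambda>m. (2 * (k - m), m)) ` (S \<union> T)"
  proof (intro equalityI subsetI)
    fix p assume "p \<in> {(n, m) \<in> gens. n + 2 * m = h}"
    then obtain n m where p: "p = (n, m)" "(n, m) \<in> gens" "n + 2 * m = 2 * k" unfolding h by auto
    then have n: "n = 2 * (k - m)" "m \<le> k" by auto
    have "m \<in> S \<union> T" using p(2) 1[OF n(2)] unfolding n(1) by blast
    moreover have "p = (2 * (k - m), m)" by (simp add: p(1) n(1))
    ultimately show "p \<in> (\<lambda>m. (2 * (k - m), m)) ` (S \<union> T)" by (rule image_eqI[rotated])
  next
    fix p assume "p \<in> (\<lambda>m. (2 * (k - m), m)) ` (S \<union> T)"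
    then obtain m where "p = (2 * (k - m), m)" "m \<in> S \<union> T" by blast
    moreover from this have "m \<le> k" by (intro le)
    ultimately show "p \<in> {(n, m) \<in> gens. n + 2 * m = h}" 
      using 1[of m] h by auto
  qed
  moreover have "inj_on (\<lambda>m. (2 * (k - m), m)) (S \<union> T)" by (auto intro: inj_onI)
  ultimately have "card {(n, m) \<in> gens. n + 2 * m = h} = card (S \<union> T)"
    by (simp add: card_image)
  also have "\<dots> = card S + card T"
  proof (rule card_Un_disjoint)
    have "odd k" if "k mod 4 = 3" using that by presburger
    then show "S \<inter> T = {}" by (auto simp: S_def T_def c_def)
  qed (simp_all add: S_def T_def)
  also have "card S = (k + 4 - c) div 4"
    unfolding S_def by (rule card_mod_class) (simp_all add: c_def)
  also have "card T = of_bool (k mod 4 \<in> {0, 3})"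
    unfolding T_def by (cases "k mod 4 \<in> {0, 3}") simp_all
  also have "(k + 4 - c) div 4 + of_bool (k mod 4 \<in> {0, 3}) = h div 8 + 1 + of_bool (h mod 8 = 6)"
  proof -
    define q where "q = k div 4"
    consider "k mod 4 = 0" | "k mod 4 = 1" | "k mod 4 = 2" | "k mod 4 = 3" by linarith
    then show ?thesis
    proof cases
      case 1
      then have k: "k = 4 * q" unfolding q_def by presburger
      have c: "c = 2" by (simp add: c_def k)
      have "(k + 4 - c) div 4 = q" unfolding k c by presburger
      moreover have "h div 8 = q" "h mod 8 = 0" unfolding h k by presburger+
      ultimately show ?thesis using 1 by simp
    next
      case 2
      then have k: "k = 4 * q + 1" unfolding q_def by presburger
      have c: "c = 0" by (simp add: c_def k)
      have "(k + 4 - c) div 4 = q + 1" unfolding k c by presburger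
      moreover have "h div 8 = q" "h mod 8 = 2" unfolding h k by presburger+
      ultimately show ?thesis using 2 by simp
    next
      case 3
      then have k: "k = 4 * q + 2" unfolding q_def by presburger
      have c: "c = 2" by (simp add: c_def k)
      have "(k + 4 - c) div 4 = q + 1" unfolding k c by presburger
      moreover have "h div 8 = q" "h mod 8 = 4" unfolding h k by presburger+
      ultimately show ?thesis using 3 by simp
    next
      case 4
      then have k: "k = 4 * q + 3" unfolding q_def by presburger
      have c: "c = 0" by (simp add: c_def k)
      have "(k + 4 - c) div 4 = q + 1" unfolding k c by presburger
      moreover have "h div 8 = q" "h mod 8 = 6" unfolding h k by presburger+
      ultimately show ?thesis using 4 by simp
    qed
  qed
  finally show ?thesis using True by simp
qed

text \<open>Multiplying by the common denominator turns the identity into a comparison with the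
  polynomial 1 + t^2 + t^6 - t^10, checked coefficient by coefficient.\<close>

lemma fps_gens_degree:
  "Abs_fps (\<lambda>h. of_nat (if even h then h div 8 + 1 + of_bool (h mod 8 = 6) else 0)) =
    ((fps_X ^ 2 + fps_X ^ 4) / ((1 - fps_X ^ 4) * (1 - fps_X ^ 8))
      + (1 + fps_X ^ 6) / (1 - fps_X ^ 8) :: rat fps)"
  (is "Abs_fps ?f = ?A / (?P * ?Q) + ?B / ?Q")
proof -
  let ?F = "Abs_fps ?f :: rat fps"
  have F: "?F * (?P * ?Q) = ?A + ?B * ?P"
  proof -
    have "?F * (?P * ?Q) = ?F - fps_X ^ 4 * ?F - fps_X ^ 8 * ?F + fps_X ^ 12 * ?F"
      by (simp add: algebra_simps flip: power_add)
    also have "\<dots> = 1 + fps_X ^ 2 + fps_X ^ 6 - fps_X ^ 10"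
    proof (rule fps_ext)
      fix n
      have "fps_nth (?F - fps_X ^ 4 * ?F - fps_X ^ 8 * ?F + fps_X ^ 12 * ?F) n =
          ?f n - (if n < 4 then 0 else ?f (n - 4)) - (if n < 8 then 0 else ?f (n - 8))
            + (if n < 12 then 0 else ?f (n - 12))"
        by (simp only: fps_sub_nth fps_add_nth fps_X_power_mult_nth fps_nth_Abs_fps)
      also have "\<dots> = of_bool (n = 0) + of_bool (n = 2) + of_bool (n = 6) - of_bool (n = 10)"
      proof (cases "n < 12")
        case True
        then have "n \<in> {0, 1, 2, 3, 4, 5, 6, 7, 8, 9, 10, 11}"
          by (simp only: insert_iff empty_iff) presburger
        then show ?thesis unfolding insert_iff empty_iff by (elim disjE) simp_all
      next
        case False
        then obtain r where n: "n = r + 12" by (metis add.commute le_Suc_ex not_less)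
        \<comment> \<open>A shift by 8 raises the count in an even degree by 1, so the terms at
          \<open>r + 12\<close> and \<open>r + 4\<close> and those at \<open>r + 8\<close> and
          \<open>r\<close> contribute differences that cancel.\<close>
        have r: "(r + 8) div 8 = r div 8 + 1" "(r + 8) mod 8 = r mod 8"
          "(r + 12) div 8 = (r + 4) div 8 + 1" "(r + 12) mod 8 = (r + 4) mod 8"
          by presburger+
        have "r + 12 - 4 = r + 8" "r + 12 - 8 = r + 4" "r + 12 - 12 = r" by simp_all
        then show ?thesis unfolding n by (simp add: r add.commute[of 4 r])
      qed
      also have "\<dots> = fps_nth (1 + fps_X ^ 2 + fps_X ^ 6 - fps_X ^ 10) n"
        by (simp only: fps_sub_nth fps_add_nth fps_X_power_nth fps_one_nth of_bool_def)
      finally show "fps_nth (?F - fps_X ^ 4 * ?F - fps_X ^ 8 * ?F + fps_X ^ 12 * ?F) n =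
        fps_nth (1 + fps_X ^ 2 + fps_X ^ 6 - fps_X ^ 10) n" .
    qed
    also have "\<dots> = ?A + ?B * ?P"
      by (simp add: algebra_simps flip: power_add)
    finally show ?thesis .
  qed
  \<comment> \<open>Nonzero constant terms make the denominators units, so the divisions of power
    series are exact.\<close>
  have nz: "fps_nth (?P * ?Q) 0 \<noteq> 0" "fps_nth ?Q 0 \<noteq> 0"
    by simp_all
  have "(?A / (?P * ?Q) + ?B / ?Q) * (?P * ?Q) = ?A / (?P * ?Q) * (?P * ?Q) + ?B / ?Q * ?Q * ?P"
    by (simp only: distrib_left mult_ac)
  also have "?A / (?P * ?Q) * (?P * ?Q) = ?A"
    by (rule dvd_div_mult_self, rule unit_imp_dvd) (simp only: fps_is_unit_iff nz not_False_eq_True)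
  also have "?B / ?Q * ?Q = ?B"
    by (rule dvd_div_mult_self, rule unit_imp_dvd) (simp only: fps_is_unit_iff nz not_False_eq_True)
  finally have "(?A / (?P * ?Q) + ?B / ?Q) * (?P * ?Q) = ?F * (?P * ?Q)"
    by (simp only: F)
  moreover have "?P * ?Q \<noteq> 0"
  proof
    assume "?P * ?Q = 0"
    with nz(1) show False by (simp only: fps_zero_nth)
  qed
  ultimately have "?A / (?P * ?Q) + ?B / ?Q = ?F"
    by (rule mult_right_cancel[THEN iffD1, rotated])
  then show ?thesis by (rule sym)
qed

context thom_module
begin

lemma hilbert_series_Q_int:
  "hilbert_series (Q_int act) =
    (fps_X ^ 2 + fps_X ^ 4) / ((1 - fps_X ^ 4) * (1 - fps_X ^ 8)) + (1 + fps_X ^ 6) / (1 - fps_X ^ 8)"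
  unfolding hilbert_series_def dim_Q_int card_gens_degree by (rule fps_gens_degree)

lemma hilbert_series_Q_coh: "hilbert_series (Q_coh act) = fps_X ^ 2 * hilbert_series (Q_int act)"
proof (rule fps_ext)
  fix d
  show "fps_nth (hilbert_series (Q_coh act)) d = fps_nth (fps_X ^ 2 * hilbert_series (Q_int act)) d"
  proof (cases "d < 2")
    case True
    then show ?thesis
      by (simp only: hilbert_series_def fps_X_power_mult_nth fps_nth_Abs_fps dim_Q_coh_low
          if_True of_nat_0)
  next
    case False
    then have "Q_coh act d = Q_int act (d - 2)" using Q_coh_Suc_Suc[of "d - 2"] by (simp only: le_add_diff_inverse2 not_less)
    with False show ?thesis
      by (simp only: hilbert_series_def fps_X_power_mult_nth fps_nth_Abs_fps if_False)
  qed
qed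

end

theorem proposition7p1:
  fixes act :: "steenrod \<Rightarrow> MO2 \<Rightarrow> MO2"
  assumes "A1_module act"
    and "\<And>n m. act (Sq 1) (v n m) = scale (of_nat (n + m + 1)) (v (n + 1) m)"
    and "\<And>n m. act (Sq 2) (v n m) =
      scale (of_nat ((n + m + 1) choose 2)) (v (n + 2) m) + scale (of_nat (m + 1)) (v n (m + 1))"
  shows "minimal_homogeneous_generating_set act (G23 \<union> G01)
    \<and> G23 \<inter> G01 = {}
    \<and> hilbert_series (Q_int act) =
      (fps_X ^ 2 + fps_X ^ 4) / ((1 - fps_X ^ 4) * (1 - fps_X ^ 8)) + (1 + fps_X ^ 6) / (1 - fps_X ^ 8)
    \<and> hilbert_series (Q_coh act) = fps_X ^ 2 * hilbert_series (Q_int act)"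
proof -
  interpret thom_module act by unfold_locales (fact assms)+
  show ?thesis
    by (intro conjI minimal_generating_set G_disjoint hilbert_series_Q_int hilbert_series_Q_coh)
qed

end
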